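(* Let $d\ge 1$, let $\{|j\rangle\}_{j=0}^{d-1}$ be an orthonormal basis of $\mathbb{C}^d$, let $H=\sum_{j=0}^{d-1}E_j|j\rangle\langle j|$ with $E_j\in\mathbb{R}$, and let $0<T<T'<\infty$. Let $\rho_T,\rho_{T'}$ be the thermal states of $H$ at temperatures $T,T'$, and put $\Delta E=\mathrm{Tr}[H(\rho_{T'}-\rho_T)]$. Then there exists a transformation $R$ on $\mathbb{C}^d$, whose matrix in the basis $\{|j\rangle\}$ is real orthogonal, such that $$\mathrm{Tr}[H(R\rho_TR^{\dagger}-\rho_T)]=\Delta E\qquad\text{and}\qquad C_r(R\rho_TR^{\dagger})=S(\rho_{T'})-S(\rho_T),$$ and this value is the maximum coherence that can be created at energy cost $\Delta E$, i.e. $C_r(V\rho_TV^\dagger)\le S(\rho_{T'})-S(\rho_T)$ for every unitary $V$ with $\mathrm{Tr}[H(V\rho_TV^\dagger-\rho_T)]=\Delta E$.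
   Context: The thermal state of $H$ at temperature $T=1/\beta$ (Boltzmann constant set to 1) is $\rho_T=e^{-\beta H}/\mathrm{Tr}[e^{-\beta H}]$. Logarithms are to base 2. $S(\rho)=-\mathrm{Tr}(\rho\log\rho)$ is the von Neumann entropy. The relative entropy of coherence of a density matrix $\rho$ with respect to the energy eigenbasis $\{|j\rangle\}$ is $C_r(\rho)=S(\rho^D)-S(\rho)$, where $\rho^D=\sum_j\langle j|\rho|j\rangle\,|j\rangle\langle j|$. The energy cost of applying a unitary $V$ to $\rho_T$ is $\mathrm{Tr}[H(V\rho_TV^\dagger-\rho_T)]$. *)

theory Defs
  imports Complex_Main "Jordan_Normal_Form.Schur_Decomposition"
begin

definition mat_trace :: "complex mat \<Rightarrow> complex" where
  "mat_trace A = (\<Sum>i<dim_row A. A $$ (i,i))"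

definition unitary_mat :: "nat \<Rightarrow> complex mat \<Rightarrow> bool" where
  "unitary_mat n U \<longleftrightarrow> U \<in> carrier_mat n n \<and> mat_adjoint U * U = 1\<^sub>m n \<and> U * mat_adjoint U = 1\<^sub>m n"

text \<open>The library predicate \<open>orthogonal_mat\<close> does not require the columns to be normalised, so it
  is not used here.\<close>

definition real_orthogonal_mat :: "nat \<Rightarrow> complex mat \<Rightarrow> bool" where
  "real_orthogonal_mat n M \<longleftrightarrow> M \<in> carrier_mat n n \<and> (\<forall>i<n. \<forall>j<n. M $$ (i,j) \<in> \<real>) \<and>
     transpose_mat M * M = 1\<^sub>m n \<and> M * transpose_mat M = 1\<^sub>m n"

text \<open>Orthonormal bases of \<open>\<complex>\<^sup>n\<close>, indexed by \<open>0, \<dots>, n - 1\<close>; values of \<open>b\<close> at other indices are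
  irrelevant. Spanning is automatic for \<open>n\<close> orthonormal vectors.\<close>

definition orthonormal_basis :: "nat \<Rightarrow> (nat \<Rightarrow> complex vec) \<Rightarrow> bool" where
  "orthonormal_basis n b \<longleftrightarrow> (\<forall>i<n. b i \<in> carrier_vec n) \<and>
     (\<forall>i<n. \<forall>j<n. b i \<bullet>c b j = (if i = j then 1 else 0))"

text \<open>\<open>\<langle>v|A|w\<rangle>\<close>; note that \<open>\<bullet>c\<close> is conjugate-linear in its second argument.\<close>

definition matrix_element :: "complex vec \<Rightarrow> complex mat \<Rightarrow> complex vec \<Rightarrow> complex" where
  "matrix_element v A w = (A *\<^sub>v w) \<bullet>c v"

definition matrix_in_basis :: "nat \<Rightarrow> (nat \<Rightarrow> complex vec) \<Rightarrow> complex mat \<Rightarrow> complex mat" where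
  "matrix_in_basis n b A = mat n n (\<lambda>(i,j). matrix_element (b i) A (b j))"

text \<open>The operator \<open>\<Sum>\<^sub>j f j |b j\<rangle>\<langle>b j|\<close>, given by its entries in the standard basis.\<close>

definition diag_op :: "nat \<Rightarrow> (nat \<Rightarrow> complex vec) \<Rightarrow> (nat \<Rightarrow> complex) \<Rightarrow> complex mat" where
  "diag_op n b f = mat n n (\<lambda>(k,l). \<Sum>j<n. f j * (b j $ k * cnj (b j $ l)))"

definition mat_exp :: "complex mat \<Rightarrow> complex mat" where
  "mat_exp A = mat (dim_row A) (dim_row A) (\<lambda>(i,j). \<Sum>k. (A ^\<^sub>m k) $$ (i,j) / fact k)"

text \<open>Functional calculus for Hermitian matrices: if \<open>A = \<Sum>\<^sub>j e j |b j\<rangle>\<langle>b j|\<close> with real \<open>e j\<close>, then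
  \<open>f(A) = \<Sum>\<^sub>j f(e j) |b j\<rangle>\<langle>b j|\<close>. Lemma \<open>herm_fun_diag_op\<close> below shows that the result does not
  depend on the chosen eigenbasis.\<close>

definition herm_fun :: "(real \<Rightarrow> real) \<Rightarrow> complex mat \<Rightarrow> complex mat" where
  "herm_fun f A = (THE B. \<exists>b e. orthonormal_basis (dim_row A) b \<and>
     A = diag_op (dim_row A) b (\<lambda>j. complex_of_real (e j)) \<and>
     B = diag_op (dim_row A) b (\<lambda>j. complex_of_real (f (e j))))"

text \<open>Since \<open>log 2 0 = 0\<close>, the usual convention \<open>0 log 0 = 0\<close> holds. The trace is real for
  Hermitian \<open>\<rho>\<close>, so taking the real part only changes its type.\<close>

definition vn_entropy :: "complex mat \<Rightarrow> real" where
  "vn_entropy \<rho> = - Re (mat_trace (\<rho> * herm_fun (log 2) \<rho>))"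

definition thermal_state :: "complex mat \<Rightarrow> real \<Rightarrow> complex mat" where
  "thermal_state H T = (let \<beta> = 1 / T; G = mat_exp (complex_of_real (- \<beta>) \<cdot>\<^sub>m H)
     in (1 / mat_trace G) \<cdot>\<^sub>m G)"

definition dephase :: "nat \<Rightarrow> (nat \<Rightarrow> complex vec) \<Rightarrow> complex mat \<Rightarrow> complex mat" where
  "dephase n b \<rho> = diag_op n b (\<lambda>j. matrix_element (b j) \<rho> (b j))"

definition rel_entropy_coherence :: "nat \<Rightarrow> (nat \<Rightarrow> complex vec) \<Rightarrow> complex mat \<Rightarrow> real" where
  "rel_entropy_coherence n b \<rho> = vn_entropy (dephase n b \<rho>) - vn_entropy \<rho>"

definition conj_by :: "complex mat \<Rightarrow> complex mat \<Rightarrow> complex mat" where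
  "conj_by V \<rho> = V * \<rho> * mat_adjoint V"

definition energy_cost :: "complex mat \<Rightarrow> complex mat \<Rightarrow> complex mat \<Rightarrow> complex" where
  "energy_cost H \<rho> V = mat_trace (H * (conj_by V \<rho> - \<rho>))"


lemma mat_adjoint_carrier: "A \<in> carrier_mat n m \<Longrightarrow> mat_adjoint A \<in> carrier_mat m n"
  by (auto simp: mat_adjoint_def)

lemma mat_adjoint_index:
  fixes A :: "complex mat"
  assumes "A \<in> carrier_mat n m" "i < m" "j < n"
  shows "mat_adjoint A $$ (i,j) = cnj (A $$ (j,i))"
  using assms by (auto simp: mat_adjoint_def mat_of_rows_index)

definition basis_mat :: "nat \<Rightarrow> (nat \<Rightarrow> complex vec) \<Rightarrow> complex mat" where
  "basis_mat n b = mat n n (\<lambda>(k,j). b j $ k)"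

lemma basis_mat_carrier: "basis_mat n b \<in> carrier_mat n n"
  by (simp add: basis_mat_def)

lemma adjoint_basis_mat_index:
  "i < n \<Longrightarrow> j < n \<Longrightarrow> mat_adjoint (basis_mat n b) $$ (i,j) = cnj (b i $ j)"
  by (subst mat_adjoint_index[OF basis_mat_carrier]) (auto simp: basis_mat_def)

lemma basis_mat_index: "i < n \<Longrightarrow> j < n \<Longrightarrow> basis_mat n b $$ (i,j) = b j $ i"
  by (simp add: basis_mat_def)

lemma unitary_basis_mat:
  assumes "orthonormal_basis n b"
  shows "unitary_mat n (basis_mat n b)"
proof -
  let ?U = "basis_mat n b"
  note U = basis_mat_carrier[of n b]
  note A = mat_adjoint_carrier[OF U]
  have *: "mat_adjoint ?U * ?U = 1\<^sub>m n"
  proof (rule eq_matI)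
    fix i j assume "i < dim_row (1\<^sub>m n :: complex mat)" "j < dim_col (1\<^sub>m n :: complex mat)"
    hence ij: "i < n" "j < n" by auto
    have "(mat_adjoint ?U * ?U) $$ (i,j) = (\<Sum>k<n. cnj (b i $ k) * b j $ k)"
      using ij U A by (auto simp: scalar_prod_def adjoint_basis_mat_index basis_mat_index lessThan_atLeast0
          intro!: sum.cong)
    also have "\<dots> = b j \<bullet>c b i"
    proof -
      have "b i \<in> carrier_vec n" using assms ij by (simp add: orthonormal_basis_def)
      thus ?thesis by (simp add: scalar_prod_def lessThan_atLeast0 mult.commute)
    qed
    also have "\<dots> = (1\<^sub>m n :: complex mat) $$ (i,j)"
      using assms ij by (auto simp: orthonormal_basis_def)
    finally show "(mat_adjoint ?U * ?U) $$ (i,j) = 1\<^sub>m n $$ (i,j)" .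
  qed (use U A in auto)
  with mat_mult_left_right_inverse[OF A U *] U show ?thesis by (simp add: unitary_mat_def)
qed

lemma diag_op_eq: "diag_op n b f = basis_mat n b * mat_diag n f * mat_adjoint (basis_mat n b)"
proof (rule eq_matI)
  note U = basis_mat_carrier[of n b]
  note A = mat_adjoint_carrier[OF U]
  let ?R = "basis_mat n b * mat_diag n f * mat_adjoint (basis_mat n b)"
  show "dim_row (diag_op n b f) = dim_row ?R" "dim_col (diag_op n b f) = dim_col ?R"
    using U A by (auto simp: diag_op_def)
  fix i j assume "i < dim_row ?R" "j < dim_col ?R"
  hence ij: "i < n" "j < n" using U A by auto
  show "diag_op n b f $$ (i,j) = ?R $$ (i,j)"
    using ij U A by (subst mat_diag_mult_right[OF U])
      (auto simp: diag_op_def scalar_prod_def adjoint_basis_mat_index basis_mat_index lessThan_atLeast0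
          intro!: sum.cong)
qed

lemma herm_fun_unique:
  fixes e e' :: "nat \<Rightarrow> real" and f :: "real \<Rightarrow> real"
  assumes b: "orthonormal_basis n b" and b': "orthonormal_basis n b'"
    and eq: "diag_op n b (\<lambda>j. complex_of_real (e j)) = diag_op n b' (\<lambda>j. complex_of_real (e' j))"
  shows "diag_op n b (\<lambda>j. complex_of_real (f (e j))) = diag_op n b' (\<lambda>j. complex_of_real (f (e' j)))"
proof -
  define U V where "U = basis_mat n b" and "V = basis_mat n b'"
  define Us Vs where "Us = mat_adjoint U" and "Vs = mat_adjoint V"
  define D D' where "D = mat_diag n (\<lambda>j. complex_of_real (e j))" and "D' = mat_diag n (\<lambda>j. complex_of_real (e' j))"
  define F F' where "F = mat_diag n (\<lambda>j. complex_of_real (f (e j)))" and "F' = mat_diag n (\<lambda>j. complex_of_real (f (e' j)))"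
  have c: "U \<in> carrier_mat n n" "V \<in> carrier_mat n n" "Us \<in> carrier_mat n n" "Vs \<in> carrier_mat n n"
    "D \<in> carrier_mat n n" "D' \<in> carrier_mat n n" "F \<in> carrier_mat n n" "F' \<in> carrier_mat n n"
    by (auto simp: U_def V_def Us_def Vs_def D_def D'_def F_def F'_def
        intro: basis_mat_carrier mat_adjoint_carrier)
  have u: "Us * U = 1\<^sub>m n" "U * Us = 1\<^sub>m n" "Vs * V = 1\<^sub>m n" "V * Vs = 1\<^sub>m n"
    using unitary_basis_mat[OF b] unitary_basis_mat[OF b']
    by (auto simp: U_def V_def Us_def Vs_def unitary_mat_def)
  have E: "U * D * Us = V * D' * Vs"
    using eq unfolding diag_op_eq D_def D'_def U_def V_def Us_def Vs_def .
  define W where "W = Vs * U"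
  have W: "W \<in> carrier_mat n n" using c by (auto simp: W_def)
  note m = assoc_mult_mat[where ?n\<^sub>1.0=n and ?n\<^sub>2.0=n and ?n\<^sub>3.0=n and ?n\<^sub>4.0=n]
  have "W * D = Vs * (U * D * Us) * U"
    using c u by (simp add: W_def m)
  also have "\<dots> = Vs * (V * D' * Vs) * U" by (simp only: E)
  also have "\<dots> = (Vs * V) * D' * (Vs * U)"
    using c by (simp add: m)
  finally have WD: "W * D = D' * W" using c by (simp add: u W_def)
  have WF: "W * F = F' * W"
  proof (rule eq_matI)
    fix i j assume "i < dim_row (F' * W)" "j < dim_col (F' * W)"
    hence ij: "i < n" "j < n" using c W by auto
    have "W $$ (i,j) * e j = e' i * W $$ (i,j)"
      using arg_cong[OF WD, of "\<lambda>M. M $$ (i,j)"] ij W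
      unfolding D_def D'_def mat_diag_mult_left[OF W] mat_diag_mult_right[OF W] by simp
    hence "W $$ (i,j) = 0 \<or> e j = e' i" by auto
    thus "(W * F) $$ (i,j) = (F' * W) $$ (i,j)"
      using ij W
      unfolding F_def F'_def mat_diag_mult_left[OF W] mat_diag_mult_right[OF W] by auto
  qed (use c W in auto)
  have "U * F * Us = (V * Vs) * U * F * Us" using c u by simp
  also have "\<dots> = V * (W * F) * Us" using c by (simp add: W_def m)
  also have "\<dots> = V * (F' * W) * Us" by (simp only: WF)
  also have "\<dots> = V * F' * Vs * (U * Us)" using c by (simp add: W_def m)
  also have "\<dots> = V * F' * Vs" using c u by simp
  finally show ?thesis
    unfolding diag_op_eq F_def F'_def U_def V_def Us_def Vs_def .
qed

lemma herm_fun_diag_op: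
  fixes e :: "nat \<Rightarrow> real"
  assumes "orthonormal_basis n b"
  shows "herm_fun f (diag_op n b (\<lambda>j. complex_of_real (e j))) =
    diag_op n b (\<lambda>j. complex_of_real (f (e j)))"
proof -
  have d: "dim_row (diag_op n b g) = n" for g by (simp add: diag_op_def)
  show ?thesis unfolding herm_fun_def d
    by (rule the_equality) (use assms herm_fun_unique[OF assms, of _ e _ f] in metis)+
qed

end

(*
In the energy eigenbasis a unitary conjugate of a thermal state has the same spectrum p, so its
coherence is the Shannon entropy of its diagonal q minus a constant. By Gibbs' inequality the
thermal distribution p' maximises the entropy among all q of the same mean energy, which is the
upper bound. It is attained once a real orthogonal R turns diag(p) into a matrix with diagonal p'.
Since p/p' is monotone in the energy, p exceeds p' only where p' is larger than at every entry
where p falls short, so R can be composed of plane rotations, each choosing its angle by the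
intermediate value theorem so as to fix one more diagonal entry.
*)

theory Submission
  imports Defs
begin

section \<open>Prescribing the diagonal of a rotated real diagonal matrix\<close>

text \<open>The quadratic form of \<open>diag(p)\<close> at \<open>x\<close>. If \<open>x\<close> is
  row i of a real matrix R, this is the i-th diagonal entry of R \<open>diag(p)\<close> R^T.\<close>

definition weighted_square :: "nat \<Rightarrow> (nat \<Rightarrow> real) \<Rightarrow> (nat \<Rightarrow> real) \<Rightarrow> real" where
  "weighted_square n p x = (\<Sum>l<n. (x l)\<^sup>2 * p l)"

text \<open>Along the quarter circle from \<open>x\<close> (angle 0) to \<open>y\<close> (angle
  \<open>pi / 2\<close>) the quadratic form varies continuously, so it takes every value between its
  endpoint values.\<close>

lemma rotation_average:
  fixes x y p :: "nat \<Rightarrow> real"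
  assumes "weighted_square n p y \<le> t" "t \<le> weighted_square n p x"
  obtains c s where "c\<^sup>2 + s\<^sup>2 = 1" "weighted_square n p (\<lambda>l. c * x l + s * y l) = t"
proof -
  define f where "f = (\<lambda>\<theta>. \<Sum>l<n. (cos \<theta> * x l + sin \<theta> * y l)\<^sup>2 * p l)"
  have "\<exists>\<theta>. 0 \<le> \<theta> \<and> \<theta> \<le> pi / 2 \<and> f \<theta> = t"
    by (rule IVT2) (use assms in \<open>auto simp: f_def weighted_square_def intro!: continuous_intros\<close>)
  then obtain \<theta> where "f \<theta> = t" by blast
  thus thesis by (intro that[of "cos \<theta>" "sin \<theta>"]) (auto simp: f_def weighted_square_def)
qed

text \<open>The cross terms of the two squares cancel. Fixing one diagonal entry by a plane rotation
  therefore determines the other.\<close>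

lemma rotated_rows_trace:
  fixes x y p :: "nat \<Rightarrow> real"
  assumes "c\<^sup>2 + s\<^sup>2 = 1"
  shows "weighted_square n p (\<lambda>l. c * x l + s * y l) + weighted_square n p (\<lambda>l. c * y l - s * x l) =
    weighted_square n p x + weighted_square n p y"
proof -
  have "(c * x l + s * y l)\<^sup>2 * p l + (c * y l - s * x l)\<^sup>2 * p l =
      (c\<^sup>2 + s\<^sup>2) * ((x l)\<^sup>2 * p l + (y l)\<^sup>2 * p l)" for l
    by (simp add: power2_eq_square algebra_simps)
  hence "(c * x l + s * y l)\<^sup>2 * p l + (c * y l - s * x l)\<^sup>2 * p l = (x l)\<^sup>2 * p l + (y l)\<^sup>2 * p l" for l
    unfolding assms by simp
  thus ?thesis unfolding weighted_square_def sum.distrib[symmetric] by simp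
qed

text \<open>Rows are kept as functions, so that a plane rotation is a function update at two
  indices.\<close>

definition orthonormal_rows :: "nat \<Rightarrow> (nat \<Rightarrow> nat \<Rightarrow> real) \<Rightarrow> bool" where
  "orthonormal_rows n r \<longleftrightarrow> (\<forall>i<n. \<forall>j<n. (\<Sum>l<n. r i l * r j l) = (if i = j then 1 else 0))"

text \<open>The update is left multiplication by a plane rotation. Bilinearity of \<open>ip\<close>
  expresses every inner product with a new row \<open>x\<close> or \<open>y\<close> through those of
  the old rows.\<close>

lemma orthonormal_rows_rotate:
  assumes r: "orthonormal_rows n r" and jk: "j < n" "k < n" "j \<noteq> k" and cs: "c\<^sup>2 + s\<^sup>2 = 1"
  shows "orthonormal_rows n (r(j := \<lambda>l. c * r j l + s * r k l, k := \<lambda>l. c * r k l - s * r j l))"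
proof -
  define ip where "ip = (\<lambda>u v :: nat \<Rightarrow> real. \<Sum>l<n. u l * v l)"
  define x where "x = (\<lambda>l. c * r j l + s * r k l)"
  define y where "y = (\<lambda>l. c * r k l - s * r j l)"
  have R: "ip (r i) (r i') = (if i = i' then 1 else 0)" if "i < n" "i' < n" for i i'
    using r that by (auto simp: orthonormal_rows_def ip_def)
  have sym: "ip u v = ip v u" for u v by (simp add: ip_def mult.commute)
  have x: "ip x w = c * ip (r j) w + s * ip (r k) w" for w
    by (simp add: ip_def x_def distrib_right sum.distrib sum_distrib_left mult.assoc)
  have y: "ip y w = c * ip (r k) w - s * ip (r j) w" for w
    by (simp add: ip_def y_def left_diff_distrib sum_subtractf sum_distrib_left mult.assoc)
  have xr: "ip x (r i) = (if i = j then c else if i = k then s else 0)"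
    and yr: "ip y (r i) = (if i = k then c else if i = j then - s else 0)" if "i < n" for i
    using that jk by (auto simp: x y R)
  have cs': "c * c + s * s = 1" using cs by (simp add: power2_eq_square)
  have rx: "ip (r i) x = ip x (r i)" and ry: "ip (r i) y = ip y (r i)" for i
    by (rule sym)+
  have xx: "ip x x = 1"
    by (subst x) (use jk cs' in \<open>simp add: rx xr\<close>)
  have xy: "ip x y = 0"
    by (subst x) (use jk in \<open>simp add: ry yr\<close>)
  have yx: "ip y x = 0"
    by (subst sym) (rule xy)
  have yy: "ip y y = 1"
    by (subst y) (use jk cs' in \<open>simp add: ry yr\<close>)
  have "ip ((r(j := x, k := y)) i) ((r(j := x, k := y)) i') = (if i = i' then 1 else 0)"
    if "i < n" "i' < n" for i i'
    using that jk by (auto simp: R xx yy xy yx xr yr rx ry)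
  thus ?thesis unfolding orthonormal_rows_def ip_def x_def y_def by blast
qed

text \<open>If the excesses of the current diagonal over \<open>y\<close> sit at larger values of \<open>y\<close> than the
  deficits, any excess can be rotated against any deficit, and each rotation settles one entry.\<close>

lemma orthonormal_rows_prescribed_diagonal:
  fixes p y :: "nat \<Rightarrow> real"
  assumes "orthonormal_rows n r"
    and "(\<Sum>i<n. weighted_square n p (r i)) = (\<Sum>i<n. y i)"
    and "\<And>j k. j < n \<Longrightarrow> k < n \<Longrightarrow> y j < weighted_square n p (r j) \<Longrightarrow>
        weighted_square n p (r k) < y k \<Longrightarrow> y k \<le> y j"
  shows "\<exists>r'. orthonormal_rows n r' \<and> (\<forall>i<n. weighted_square n p (r' i) = y i)"
  using assms
proof (induction "card {i. i < n \<and> weighted_square n p (r i) \<noteq> y i}" arbitrary: r rule: less_induct)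
  case less
  note prems = less.prems
  let ?D = "\<lambda>r i. weighted_square n p (r i)"
  show ?case
  proof (cases "\<forall>i<n. ?D r i = y i")
    case True
    thus ?thesis using prems(1) by blast
  next
    case False
    then obtain i where i: "i < n" "?D r i \<noteq> y i" by auto
    \<comment> \<open>Both diagonals have the same sum, so one wrong entry forces both an excess
      \<open>j\<close> and a deficit \<open>k\<close>.\<close>
    have "\<exists>j<n. y j < ?D r j"
    proof (rule ccontr)
      assume "\<not> ?thesis"
      hence "\<And>i. i < n \<Longrightarrow> ?D r i \<le> y i" by force
      hence "(\<Sum>i<n. ?D r i) < (\<Sum>i<n. y i)" using i by (intro sum_strict_mono_ex1) force+
      thus False using prems(2) by simp
    qed
    then obtain j where j: "j < n" "y j < ?D r j" by blast
    have "\<exists>k<n. ?D r k < y k"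
    proof (rule ccontr)
      assume "\<not> ?thesis"
      hence "\<And>i. i < n \<Longrightarrow> ?D r i \<ge> y i" by force
      hence "(\<Sum>i<n. y i) < (\<Sum>i<n. ?D r i)" using i by (intro sum_strict_mono_ex1) force+
      thus False using prems(2) by simp
    qed
    then obtain k where k: "k < n" "?D r k < y k" by blast
    have yjk: "y k \<le> y j" using prems(3) j k by blast
    have jk: "j \<noteq> k" using j k by auto
    \<comment> \<open>The first candidate settles entry \<open>j\<close>; the second, by trace
      preservation, leaves exactly \<open>y k\<close> at \<open>k\<close>. With the larger one
      neither entry overshoots its target.\<close>
    define t where "t = max (y j) (?D r j + ?D r k - y k)"
    \<comment> \<open>The order condition enters here:
      \<open>?D r k < y k \<le> y j \<le> t\<close>. The upper bound holds because \<open>k\<close>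
      is a deficit.\<close>
    have "?D r k \<le> t" "t \<le> ?D r j" using yjk j k by (auto simp: t_def)
    then obtain c s where cs: "c\<^sup>2 + s\<^sup>2 = 1" and t: "weighted_square n p (\<lambda>l. c * r j l + s * r k l) = t"
      using rotation_average[of n p "r k" t "r j"] by blast
    define r1 where "r1 = r(j := \<lambda>l. c * r j l + s * r k l, k := \<lambda>l. c * r k l - s * r j l)"
    have o1: "orthonormal_rows n r1"
      unfolding r1_def by (rule orthonormal_rows_rotate) (use prems(1) j k jk cs in auto)
    have Dj: "?D r1 j = t" using jk t by (simp add: r1_def)
    have Djk: "?D r1 j + ?D r1 k = ?D r j + ?D r k"
      using jk rotated_rows_trace[OF cs, where x = "r j" and y = "r k" and p = p and n = n] by (simp add: r1_def)
    have Dk: "?D r1 k = ?D r j + ?D r k - t" using Dj Djk by simp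
    have Do: "?D r1 i = ?D r i" if "i \<noteq> j" "i \<noteq> k" for i using that by (simp add: r1_def)
    have tj: "y j \<le> t" by (simp add: t_def)
    have tk: "?D r1 k \<le> y k" unfolding Dk t_def by simp
    have "(\<Sum>i<n. ?D r1 i - ?D r i) = (\<Sum>i\<in>{j,k}. ?D r1 i - ?D r i)"
      by (rule sum.mono_neutral_right) (use j k Do in auto)
    also have "\<dots> = 0" using jk Djk by simp
    finally have s1: "(\<Sum>i<n. ?D r1 i) = (\<Sum>i<n. y i)" using prems(2) by (simp add: sum_subtractf)
    \<comment> \<open>No excess or deficit is created: the order condition carries over to
      \<open>r1\<close>, and settled entries stay settled.\<close>
    have pos: "y i < ?D r i" if "y i < ?D r1 i" for i
      using that j tk Do[of i] by (cases "i = j"; cases "i = k") auto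
    have neg: "?D r i < y i" if "?D r1 i < y i" for i
      using that k tj Dj Do[of i] by (cases "i = j"; cases "i = k") auto
    \<comment> \<open>Whichever candidate attains the maximum in \<open>t\<close>, its entry becomes
      exact, so the number of wrong entries drops.\<close>
    have "?D r1 j = y j \<or> ?D r1 k = y k" unfolding Dk Dj t_def by linarith
    then obtain m where m: "m < n" "?D r1 m = y m" "?D r m \<noteq> y m"
      using j k by (metis less_irrefl)
    have "i \<in> {i. i < n \<and> ?D r i \<noteq> y i}" if "i \<in> {i. i < n \<and> ?D r1 i \<noteq> y i}" for i
      using that pos[of i] neg[of i] by (cases "?D r1 i" "y i" rule: linorder_cases) auto
    hence "{i. i < n \<and> ?D r1 i \<noteq> y i} \<subset> {i. i < n \<and> ?D r i \<noteq> y i}"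
      using m by blast
    hence "card {i. i < n \<and> ?D r1 i \<noteq> y i} < card {i. i < n \<and> ?D r i \<noteq> y i}"
      by (intro psubset_card_mono) auto
    thus ?thesis
      by (rule less.hyps) (use o1 s1 prems(3) pos neg in blast)+
  qed
qed

text \<open>The rotations start from the identity matrix, whose rows give the diagonal
  \<open>p\<close>.\<close>

corollary orthogonal_with_diagonal:
  fixes p y :: "nat \<Rightarrow> real"
  assumes "(\<Sum>i<n. p i) = (\<Sum>i<n. y i)"
    and "\<And>j k. j < n \<Longrightarrow> k < n \<Longrightarrow> y j < p j \<Longrightarrow> p k < y k \<Longrightarrow> y k \<le> y j"
  shows "\<exists>r. orthonormal_rows n r \<and> (\<forall>i<n. weighted_square n p (r i) = y i)"
proof -
  define r :: "nat \<Rightarrow> nat \<Rightarrow> real" where "r = (\<lambda>i l. if i = l then 1 else 0)"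
  have D: "weighted_square n p (r i) = p i" if "i < n" for i
    using that by (simp add: weighted_square_def r_def if_distrib[of "\<lambda>x. x ^ 2"] if_distrib[of "\<lambda>x. x * _"] cong: if_cong)
  have "(\<Sum>l<n. r i l * r j l) = (if i = j then 1 else 0)" if "i < n" "j < n" for i j
    using that by (simp add: r_def if_distrib[of "\<lambda>x. x * _"] cong: if_cong)
  hence o: "orthonormal_rows n r"
    by (simp add: orthonormal_rows_def)
  show ?thesis
    by (rule orthonormal_rows_prescribed_diagonal[OF o]) (use assms D in auto)
qed

section \<open>Gibbs weights\<close>

text \<open>Apply \<open>ln x \<le> x - 1\<close> termwise at \<open>x = p i / q i\<close>; the
  resulting bounds sum to zero since both totals agree. Where \<open>q i = 0\<close>, the left side
  of the termwise bound vanishes.\<close>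

lemma gibbs_inequality:
  fixes p q :: "nat \<Rightarrow> real"
  assumes "\<And>i. i < n \<Longrightarrow> 0 \<le> q i" "\<And>i. i < n \<Longrightarrow> 0 < p i" "(\<Sum>i<n. q i) = (\<Sum>i<n. p i)"
  shows "(\<Sum>i<n. q i * log 2 (p i)) \<le> (\<Sum>i<n. q i * log 2 (q i))"
proof -
  have "q i * log 2 (p i) - q i * log 2 (q i) \<le> (p i - q i) / ln 2" if "i < n" for i
  proof (cases "q i = 0")
    case True
    thus ?thesis using assms(2)[OF that] by simp
  next
    case False
    hence q: "q i > 0" using assms(1)[OF that] by simp
    have p: "p i > 0" using assms(2) that by simp
    have "ln (p i) - ln (q i) \<le> p i / q i - 1"
      using p q by (metis ln_div ln_le_minus_one divide_pos_pos less_irrefl)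
    hence "q i * (ln (p i) - ln (q i)) \<le> q i * (p i / q i - 1)" using q by (intro mult_left_mono) auto
    also have "\<dots> = p i - q i" using q by (simp add: field_simps)
    finally have "q i * (ln (p i) - ln (q i)) / ln 2 \<le> (p i - q i) / ln 2"
      by (intro divide_right_mono) auto
    thus ?thesis by (simp add: log_def diff_divide_distrib right_diff_distrib)
  qed
  hence "(\<Sum>i<n. q i * log 2 (p i) - q i * log 2 (q i)) \<le> (\<Sum>i<n. (p i - q i) / ln 2)"
    by (intro sum_mono) auto
  also have "\<dots> = 0" by (simp add: sum_divide_distrib[symmetric] sum_subtractf assms(3))
  finally show ?thesis by (simp add: sum_subtractf)
qed

definition partition_function :: "nat \<Rightarrow> (nat \<Rightarrow> real) \<Rightarrow> real \<Rightarrow> real" where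
  "partition_function n E T = (\<Sum>j<n. exp (- E j / T))"

definition gibbs_weight :: "nat \<Rightarrow> (nat \<Rightarrow> real) \<Rightarrow> real \<Rightarrow> nat \<Rightarrow> real" where
  "gibbs_weight n E T j = exp (- E j / T) / partition_function n E T"

lemma partition_function_pos: "0 < n \<Longrightarrow> 0 < partition_function n E T"
  unfolding partition_function_def by (intro sum_pos) auto

lemma gibbs_weight_pos: "0 < n \<Longrightarrow> 0 < gibbs_weight n E T j"
  by (simp add: gibbs_weight_def partition_function_pos)

lemma sum_gibbs_weight: "0 < n \<Longrightarrow> (\<Sum>j<n. gibbs_weight n E T j) = 1"
  using partition_function_pos[of n E T] by (simp add: gibbs_weight_def partition_function_def flip: sum_divide_distrib)

text \<open>Heating moves weight from low to high energies: the ratio of the two weights is monotone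
  in the energy.\<close>

lemma gibbs_weight_crossing:
  assumes "0 < n" "0 < T" "T < T'"
    and j: "gibbs_weight n E T' j < gibbs_weight n E T j"
    and k: "gibbs_weight n E T k < gibbs_weight n E T' k"
  shows "gibbs_weight n E T' k \<le> gibbs_weight n E T' j"
proof -
  define Z Z' where "Z = partition_function n E T" and "Z' = partition_function n E T'"
  have Z: "Z > 0" "Z' > 0" using assms(1) by (auto simp: Z_def Z'_def partition_function_pos)
  \<comment> \<open>The drop in inverse temperature. By \<open>split\<close>, the weights at
    \<open>T\<close> and \<open>T'\<close> have ratio \<open>exp (- (g * E i)) * Z' / Z\<close>,
    which decreases with the energy.\<close>
  define g where "g = 1 / T - 1 / T'"
  have g: "g > 0" using assms(2,3) by (simp add: g_def field_simps)
  have split: "exp (- E i / T) = exp (- (g * E i)) * exp (- E i / T')" for i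
    by (simp add: exp_add[symmetric] g_def algebra_simps)
  have "exp (- E j / T') * Z < exp (- E j / T) * Z'"
    using j Z by (simp add: gibbs_weight_def field_simps flip: Z_def Z'_def)
  hence 1: "Z < exp (- (g * E j)) * Z'"
    unfolding split[of j] by (simp add: mult.assoc mult.left_commute)
  have "exp (- E k / T) * Z' < exp (- E k / T') * Z"
    using k Z by (simp add: gibbs_weight_def field_simps flip: Z_def Z'_def)
  hence 2: "exp (- (g * E k)) * Z' < Z"
    unfolding split[of k] by (simp add: mult.assoc mult.left_commute)
  \<comment> \<open>The ratio of weights exceeds 1 at \<open>j\<close> and is below 1 at
    \<open>k\<close>, so \<open>j\<close> has the lower energy and hence the larger weight at
    \<open>T'\<close>.\<close>
  have "exp (- (g * E k)) < exp (- (g * E j))"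
    using less_trans[OF 2 1] Z by simp
  hence "E j < E k" using g by simp
  hence "- E k / T' \<le> - E j / T'" using assms(2,3) by (simp add: divide_right_mono)
  thus ?thesis using Z(2) by (simp add: gibbs_weight_def divide_right_mono flip: Z'_def)
qed

text \<open>The logarithm of a Gibbs weight is affine in the energy, so this cross entropy depends
  on \<open>q\<close> only through its mean energy.\<close>

lemma sum_log_gibbs_weight:
  assumes "0 < n" "(\<Sum>j<n. q j) = 1"
  shows "(\<Sum>j<n. q j * log 2 (gibbs_weight n E T j)) =
    (- (\<Sum>j<n. E j * q j) / T - ln (partition_function n E T)) / ln 2"
proof -
  define Z where "Z = partition_function n E T"
  have Z: "Z > 0" using assms by (simp add: Z_def partition_function_pos)
  have "q j * log 2 (gibbs_weight n E T j) = - (E j * q j) / (T * ln 2) - q j * (ln Z / ln 2)" for j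
    using Z by (simp add: gibbs_weight_def log_def ln_div diff_divide_distrib algebra_simps flip: Z_def)
  hence "(\<Sum>j<n. q j * log 2 (gibbs_weight n E T j)) =
      - (\<Sum>j<n. E j * q j) / (T * ln 2) - (\<Sum>j<n. q j) * (ln Z / ln 2)"
    by (simp add: sum_subtractf sum_negf sum_divide_distrib sum_distrib_right)
  thus ?thesis by (simp add: assms(2) Z_def diff_divide_distrib)
qed

text \<open>With equal mean energies, \<open>q\<close> and the Gibbs weights have the same cross
  entropy against the Gibbs weights. For the latter it is their own entropy; for \<open>q\<close> it
  is an upper bound by Gibbs' inequality.\<close>

lemma gibbs_weight_max_entropy:
  assumes "0 < n" "\<And>j. j < n \<Longrightarrow> 0 \<le> q j" "(\<Sum>j<n. q j) = 1"
    and "(\<Sum>j<n. E j * q j) = (\<Sum>j<n. E j * gibbs_weight n E T j)"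
  shows "- (\<Sum>j<n. q j * log 2 (q j)) \<le>
    - (\<Sum>j<n. gibbs_weight n E T j * log 2 (gibbs_weight n E T j))"
  using gibbs_inequality[of n q "gibbs_weight n E T"] assms
    sum_log_gibbs_weight[of n q E T] sum_log_gibbs_weight[of n "gibbs_weight n E T" E T]
  by (simp add: gibbs_weight_pos sum_gibbs_weight)

section \<open>Matrices in an orthonormal basis\<close>

lemma mat_adjoint_mult:
  fixes A B :: "complex mat"
  assumes "A \<in> carrier_mat n m" "B \<in> carrier_mat m k"
  shows "mat_adjoint (A * B) = mat_adjoint B * mat_adjoint A"
proof (rule eq_matI)
  have AB: "A * B \<in> carrier_mat n k" using assms by simp
  note c = mat_adjoint_carrier[OF assms(1)] mat_adjoint_carrier[OF assms(2)] mat_adjoint_carrier[OF AB]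
  show "dim_row (mat_adjoint (A * B)) = dim_row (mat_adjoint B * mat_adjoint A)"
    "dim_col (mat_adjoint (A * B)) = dim_col (mat_adjoint B * mat_adjoint A)"
    using c by auto
  fix i j assume "i < dim_row (mat_adjoint B * mat_adjoint A)" "j < dim_col (mat_adjoint B * mat_adjoint A)"
  hence ij: "i < k" "j < n" using c by auto
  show "mat_adjoint (A * B) $$ (i,j) = (mat_adjoint B * mat_adjoint A) $$ (i,j)"
    using ij c assms
    by (simp add: mat_adjoint_index[OF AB] scalar_prod_def mat_adjoint_index[OF assms(1)]
        mat_adjoint_index[OF assms(2)] mult.commute)
qed

lemma mat_adjoint_adjoint:
  fixes A :: "complex mat"
  assumes "A \<in> carrier_mat n m"
  shows "mat_adjoint (mat_adjoint A) = A"
proof (rule eq_matI)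
  note c = mat_adjoint_carrier[OF assms]
  show "dim_row (mat_adjoint (mat_adjoint A)) = dim_row A" "dim_col (mat_adjoint (mat_adjoint A)) = dim_col A"
    using mat_adjoint_carrier[OF c] assms by auto
  fix i j assume "i < dim_row A" "j < dim_col A"
  thus "mat_adjoint (mat_adjoint A) $$ (i,j) = A $$ (i,j)"
    using assms by (simp add: mat_adjoint_index[OF c] mat_adjoint_index[OF assms])
qed

lemma unitary_mat_mult:
  assumes "unitary_mat n U" "unitary_mat n V"
  shows "unitary_mat n (U * V)"
proof -
  note m = assoc_mult_mat[where ?n\<^sub>1.0=n and ?n\<^sub>2.0=n and ?n\<^sub>3.0=n and ?n\<^sub>4.0=n]
  have c: "U \<in> carrier_mat n n" "V \<in> carrier_mat n n"
    and u: "mat_adjoint U * U = 1\<^sub>m n" "U * mat_adjoint U = 1\<^sub>m n"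
      "mat_adjoint V * V = 1\<^sub>m n" "V * mat_adjoint V = 1\<^sub>m n"
    using assms by (auto simp: unitary_mat_def)
  note a = mat_adjoint_carrier[OF c(1)] mat_adjoint_carrier[OF c(2)]
  have "mat_adjoint V * mat_adjoint U * (U * V) = mat_adjoint V * (mat_adjoint U * U) * V"
    using a c by (simp add: m)
  moreover have "U * V * (mat_adjoint V * mat_adjoint U) = U * (V * mat_adjoint V) * mat_adjoint U"
    using a c by (simp add: m)
  ultimately show ?thesis
    using a c u by (simp add: unitary_mat_def mat_adjoint_mult[OF c])
qed

lemma unitary_mat_adjoint: "unitary_mat n U \<Longrightarrow> unitary_mat n (mat_adjoint U)"
  by (auto simp: unitary_mat_def mat_adjoint_adjoint intro: mat_adjoint_carrier)

lemma mat_trace_comm: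
  assumes "A \<in> carrier_mat n n" "B \<in> carrier_mat n n"
  shows "mat_trace (A * B) = mat_trace (B * A)"
proof -
  have "mat_trace (A * B) = (\<Sum>i<n. \<Sum>k<n. A $$ (i,k) * B $$ (k,i))"
    using assms by (simp add: mat_trace_def scalar_prod_def lessThan_atLeast0)
  also have "\<dots> = (\<Sum>k<n. \<Sum>i<n. A $$ (i,k) * B $$ (k,i))" by (rule sum.swap)
  also have "\<dots> = mat_trace (B * A)"
    using assms by (simp add: mat_trace_def scalar_prod_def lessThan_atLeast0 mult.commute)
  finally show ?thesis .
qed

lemma mat_trace_minus:
  "A \<in> carrier_mat n n \<Longrightarrow> B \<in> carrier_mat n n \<Longrightarrow> mat_trace (A - B) = mat_trace A - mat_trace B"
  by (simp add: mat_trace_def sum_subtractf)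

text \<open>Converse of \<open>unitary_basis_mat\<close>, used to read the columns of
  \<open>V * U\<close> as a rotated eigenbasis.\<close>

lemma orthonormal_basis_col:
  assumes "unitary_mat n U"
  shows "orthonormal_basis n (col U)"
proof -
  have U: "U \<in> carrier_mat n n" and u: "mat_adjoint U * U = 1\<^sub>m n"
    using assms by (auto simp: unitary_mat_def)
  have "col U i \<bullet>c col U j = (if i = j then 1 else 0)" if "i < n" "j < n" for i j
  proof -
    have "col U i \<bullet>c col U j = (mat_adjoint U * U) $$ (j,i)"
      using that U mat_adjoint_carrier[OF U]
      by (simp add: scalar_prod_def mat_adjoint_index[OF U] mult.commute)
    thus ?thesis using that by (simp add: u)
  qed
  thus ?thesis using U by (simp add: orthonormal_basis_def)
qed

lemma basis_mat_col: "U \<in> carrier_mat n n \<Longrightarrow> basis_mat n (col U) = U"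
  by (auto simp: basis_mat_def)

lemma diag_op_carrier: "diag_op n b f \<in> carrier_mat n n"
  by (simp add: diag_op_def)

lemma mat_trace_mat_diag: "mat_trace (mat_diag n f) = (\<Sum>j<n. f j)"
  by (simp add: mat_trace_def mat_diag_def)

lemma smult_diag_op: "c \<cdot>\<^sub>m diag_op n b f = diag_op n b (\<lambda>j. c * f j)"
  by (auto simp: diag_op_def sum_distrib_left mult.assoc)

lemma diag_op_cong: "(\<And>j. j < n \<Longrightarrow> f j = g j) \<Longrightarrow> diag_op n b f = diag_op n b g"
  by (simp add: diag_op_def)

text \<open>A locale, because the facts are needed for the energy eigenbasis and also for its image
  under a unitary.\<close>

locale onb =
  fixes n :: nat and b :: "nat \<Rightarrow> complex vec"
  assumes onb: "orthonormal_basis n b"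
begin

abbreviation "U \<equiv> basis_mat n b"
abbreviation "Us \<equiv> mat_adjoint (basis_mat n b)"

lemma U: "U \<in> carrier_mat n n" and Us: "Us \<in> carrier_mat n n"
  by (auto intro: basis_mat_carrier mat_adjoint_carrier)

lemma unitary: "Us * U = 1\<^sub>m n" "U * Us = 1\<^sub>m n"
  using unitary_basis_mat[OF onb] by (auto simp: unitary_mat_def)

lemmas assoc = assoc_mult_mat[where ?n\<^sub>1.0=n and ?n\<^sub>2.0=n and ?n\<^sub>3.0=n and ?n\<^sub>4.0=n]

text \<open>Cancellation inside right-nested products, the normal form produced by
  \<open>assoc\<close>.\<close>

lemma unitary_left:
  assumes "A \<in> carrier_mat n n"
  shows "Us * (U * A) = A" "U * (Us * A) = A"
  using assms U Us by (simp_all add: unitary flip: assoc)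

text \<open>Turns the entrywise definition into a similarity transform, through which products,
  adjoints and traces pass algebraically.\<close>

lemma matrix_in_basis_eq:
  assumes "A \<in> carrier_mat n n"
  shows "matrix_in_basis n b A = Us * A * U"
proof (rule eq_matI)
  note c = U Us assms
  show "dim_row (matrix_in_basis n b A) = dim_row (Us * A * U)"
    "dim_col (matrix_in_basis n b A) = dim_col (Us * A * U)"
    using c by (auto simp: matrix_in_basis_def)
  fix i j assume "i < dim_row (Us * A * U)" "j < dim_col (Us * A * U)"
  hence ij: "i < n" "j < n" using c by auto
  have b: "b i \<in> carrier_vec n" "b j \<in> carrier_vec n" using onb ij by (auto simp: orthonormal_basis_def)
  have colU: "col U j = b j" using ij b by (intro eq_vecI) (auto simp: basis_mat_def)
  have "(Us * A * U) $$ (i,j) = (Us * (A * U)) $$ (i,j)" using c by (simp add: assoc)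
  also have "\<dots> = row Us i \<bullet> (A *\<^sub>v b j)"
    using c ij by (simp add: colU mult_mat_vec_def)
  also have "\<dots> = (A *\<^sub>v b j) \<bullet>c b i"
    using c ij b by (simp add: scalar_prod_def adjoint_basis_mat_index mult.commute)
  finally show "matrix_in_basis n b A $$ (i,j) = (Us * A * U) $$ (i,j)"
    using ij by (simp add: matrix_in_basis_def matrix_element_def)
qed

lemma matrix_in_basis_carrier: "matrix_in_basis n b A \<in> carrier_mat n n"
  by (simp add: matrix_in_basis_def)

lemma matrix_in_basis_diag_op: "matrix_in_basis n b (diag_op n b f) = mat_diag n f"
proof -
  have D: "mat_diag n f \<in> carrier_mat n n" by simp
  have "Us * (U * mat_diag n f * Us) * U = Us * (U * (mat_diag n f * (Us * U)))"
    using U Us D by (simp add: assoc mult_carrier_mat[of _ n n] del: mat_diag_dim)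
  thus ?thesis
    unfolding matrix_in_basis_eq[OF diag_op_carrier] unfolding diag_op_eq using D
    by (simp add: unitary unitary_left)
qed

lemma matrix_in_basis_mult:
  assumes "A \<in> carrier_mat n n" "B \<in> carrier_mat n n"
  shows "matrix_in_basis n b (A * B) = matrix_in_basis n b A * matrix_in_basis n b B"
  using assms U Us by (simp add: matrix_in_basis_eq assoc unitary_left)

lemma matrix_in_basis_adjoint:
  assumes "A \<in> carrier_mat n n"
  shows "matrix_in_basis n b (mat_adjoint A) = mat_adjoint (matrix_in_basis n b A)"
  using assms U Us mat_adjoint_carrier[OF assms]
  by (simp add: matrix_in_basis_eq mat_adjoint_mult[of _ n n _ n] mat_adjoint_adjoint[OF U] assoc
      mult_carrier_mat[of _ n n])

lemma mat_trace_matrix_in_basis: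
  assumes "A \<in> carrier_mat n n"
  shows "mat_trace (matrix_in_basis n b A) = mat_trace A"
proof -
  have "mat_trace (Us * A * U) = mat_trace (U * (Us * A))"
    by (rule mat_trace_comm[of _ n]) (use assms U Us in auto)
  thus ?thesis using assms by (simp add: matrix_in_basis_eq unitary_left)
qed

text \<open>In the basis \<open>b\<close> the left factor is diagonal, so the trace sees only the
  diagonal of \<open>A\<close>. Mean energy thus depends on populations alone.\<close>

lemma mat_trace_diag_op_mult:
  assumes "A \<in> carrier_mat n n"
  shows "mat_trace (diag_op n b f * A) = (\<Sum>j<n. f j * matrix_element (b j) A (b j))"
proof -
  have "mat_trace (diag_op n b f * A) = mat_trace (mat_diag n f * matrix_in_basis n b A)"
    by (metis assms diag_op_carrier mat_trace_matrix_in_basis matrix_in_basis_diag_op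
        matrix_in_basis_mult mult_carrier_mat)
  also have "\<dots> = (\<Sum>j<n. f j * matrix_element (b j) A (b j))"
    unfolding mat_diag_mult_left[OF matrix_in_basis_carrier]
    by (simp add: mat_trace_def matrix_in_basis_def)
  finally show ?thesis .
qed

lemma mat_trace_diag_op: "mat_trace (diag_op n b f) = (\<Sum>j<n. f j)"
  by (metis diag_op_carrier mat_trace_mat_diag mat_trace_matrix_in_basis matrix_in_basis_diag_op)

text \<open>The resolution of the identity.\<close>

lemma diag_op_one: "diag_op n b (\<lambda>_. 1) = 1\<^sub>m n"
  using U Us by (simp add: diag_op_eq unitary)

lemma mat_trace_eq_sum_matrix_element:
  assumes "A \<in> carrier_mat n n"
  shows "mat_trace A = (\<Sum>j<n. matrix_element (b j) A (b j))"
  using mat_trace_diag_op_mult[OF assms, of "\<lambda>_. 1"] assms by (simp add: diag_op_one)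

lemma diag_op_mult: "diag_op n b f * diag_op n b g = diag_op n b (\<lambda>j. f j * g j)"
proof -
  have "U * mat_diag n f * Us * (U * mat_diag n g * Us) = U * (mat_diag n f * mat_diag n g) * Us"
    using U Us by (simp add: assoc unitary_left mult_carrier_mat[of _ n n] del: mat_diag_diag)
  thus ?thesis by (simp add: diag_op_eq)
qed

lemma diag_op_power: "diag_op n b f ^\<^sub>m k = diag_op n b (\<lambda>j. f j ^ k)"
proof (induction k)
  case 0
  show ?case using diag_op_carrier[of n b f] by (simp add: diag_op_one)
next
  case (Suc k)
  thus ?case by (simp add: diag_op_mult mult.commute)
qed

text \<open>Each entry of the power series is a finite combination of scalar exponential
  series.\<close>

lemma mat_exp_diag_op: "mat_exp (diag_op n b f) = diag_op n b (\<lambda>j. exp (f j))"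
proof (rule eq_matI)
  fix i j assume "i < dim_row (diag_op n b (\<lambda>j. exp (f j)))" "j < dim_col (diag_op n b (\<lambda>j. exp (f j)))"
  hence ij: "i < n" "j < n" by (auto simp: diag_op_def)
  have "(\<lambda>k. \<Sum>m<n. f m ^ k /\<^sub>R fact k * (b m $ i * cnj (b m $ j))) sums
      (\<Sum>m<n. exp (f m) * (b m $ i * cnj (b m $ j)))"
    by (intro sums_sum sums_mult2 exp_converges)
  also have "(\<lambda>k. \<Sum>m<n. f m ^ k /\<^sub>R fact k * (b m $ i * cnj (b m $ j))) =
      (\<lambda>k. (diag_op n b f ^\<^sub>m k) $$ (i,j) / fact k)"
    using ij unfolding diag_op_power
    by (simp add: diag_op_def sum_divide_distrib scaleR_conv_of_real field_simps)
  finally show "mat_exp (diag_op n b f) $$ (i,j) = diag_op n b (\<lambda>j. exp (f j)) $$ (i,j)"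
    using ij by (simp add: mat_exp_def diag_op_def sums_iff)
qed (auto simp: mat_exp_def diag_op_def)

section \<open>Entropy, thermal states and unitary conjugation of diagonal operators\<close>

lemma vn_entropy_diag_op:
  "vn_entropy (diag_op n b (\<lambda>j. complex_of_real (p j))) = - (\<Sum>j<n. p j * log 2 (p j))"
  by (simp add: vn_entropy_def herm_fun_diag_op[OF onb] diag_op_mult mat_trace_diag_op)

lemma thermal_state_diag_op:
  "thermal_state (diag_op n b (\<lambda>j. complex_of_real (E j))) T =
    diag_op n b (\<lambda>j. complex_of_real (gibbs_weight n E T j))"
proof -
  have *: "mat_exp (complex_of_real (- (1 / T)) \<cdot>\<^sub>m diag_op n b (\<lambda>j. complex_of_real (E j))) =
      diag_op n b (\<lambda>j. complex_of_real (exp (- E j / T)))"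
    unfolding smult_diag_op mat_exp_diag_op
    by (intro diag_op_cong) (simp flip: exp_of_real)
  show ?thesis
    unfolding thermal_state_def Let_def * unfolding mat_trace_diag_op smult_diag_op
    by (simp add: gibbs_weight_def partition_function_def)
qed

text \<open>The product regroups around \<open>V * U\<close>: the coefficients stay, and the basis
  vectors move to its columns.\<close>

lemma conj_by_diag_op:
  assumes "V \<in> carrier_mat n n"
  shows "conj_by V (diag_op n b f) = diag_op n (col (V * U)) f"
proof -
  have VU: "V * U \<in> carrier_mat n n" using assms U by auto
  show ?thesis
    using assms U Us mat_adjoint_carrier[OF assms]
    by (simp add: conj_by_def diag_op_eq basis_mat_col[OF VU] mat_adjoint_mult[OF assms U] assoc
        mult_carrier_mat[of _ n n])
qed

text \<open>The conjugate has the same coefficients in another orthonormal basis, and the entropy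
  formula mentions only the coefficients.\<close>

lemma vn_entropy_conj_by:
  assumes "unitary_mat n V"
  shows "vn_entropy (conj_by V (diag_op n b (\<lambda>j. complex_of_real (p j)))) =
    vn_entropy (diag_op n b (\<lambda>j. complex_of_real (p j)))"
proof -
  interpret V: onb n "col (V * U)"
    by unfold_locales (intro orthonormal_basis_col unitary_mat_mult assms unitary_basis_mat onb)
  have "V \<in> carrier_mat n n" using assms by (simp add: unitary_mat_def)
  thus ?thesis
    by (simp add: conj_by_diag_op V.vn_entropy_diag_op vn_entropy_diag_op)
qed

lemma conj_by_carrier:
  "V \<in> carrier_mat n n \<Longrightarrow> A \<in> carrier_mat n n \<Longrightarrow> conj_by V A \<in> carrier_mat n n"
  by (auto simp: conj_by_def intro!: mult_carrier_mat[of _ n n] mat_adjoint_carrier)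

text \<open>In the basis \<open>b\<close> the conjugate reads W D W^*, with W the matrix of
  \<open>V\<close> and D diagonal. For real W the sum is \<open>weighted_square\<close> of a
  row.\<close>

lemma matrix_element_conj_by_diag_op:
  assumes V: "V \<in> carrier_mat n n" and j: "j < n"
  shows "matrix_element (b j) (conj_by V (diag_op n b (\<lambda>j. complex_of_real (p j)))) (b j) =
    complex_of_real (\<Sum>l<n. (cmod (matrix_in_basis n b V $$ (j,l)))\<^sup>2 * p l)"
proof -
  define W where "W = matrix_in_basis n b V"
  have W: "W \<in> carrier_mat n n" by (simp add: W_def matrix_in_basis_carrier)
  let ?A = "diag_op n b (\<lambda>j. complex_of_real (p j))"
  have "matrix_in_basis n b (conj_by V ?A) = W * mat_diag n (\<lambda>j. complex_of_real (p j)) * mat_adjoint W"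
    using V mat_adjoint_carrier[OF V]
    by (simp add: conj_by_def W_def matrix_in_basis_mult[of _ "mat_adjoint V"] matrix_in_basis_mult[OF V]
        diag_op_carrier matrix_in_basis_diag_op matrix_in_basis_adjoint mult_carrier_mat[of _ n n])
  hence "matrix_in_basis n b (conj_by V ?A) $$ (j,j) = (\<Sum>l<n. W $$ (j,l) * p l * cnj (W $$ (j,l)))"
    unfolding mat_diag_mult_right[OF W]
    using j W mat_adjoint_carrier[OF W]
    by (simp add: scalar_prod_def mat_adjoint_index[OF W] lessThan_atLeast0)
  also have "\<dots> = (\<Sum>l<n. complex_of_real ((cmod (W $$ (j,l)))\<^sup>2 * p l))"
    by (intro sum.cong) (auto simp: complex_norm_square mult_ac simp del: of_real_power)
  finally show ?thesis using j by (simp add: matrix_in_basis_def W_def)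
qed

end

section \<open>Real orthogonal matrices; coherence and energy of conjugated states\<close>

lemma real_orthogonal_mat_of_rows:
  assumes "orthonormal_rows n r"
  shows "real_orthogonal_mat n (mat n n (\<lambda>(i,j). complex_of_real (r i j)))" (is "real_orthogonal_mat n ?M")
proof -
  have M: "?M \<in> carrier_mat n n" "transpose_mat ?M \<in> carrier_mat n n" by auto
  have *: "?M * transpose_mat ?M = 1\<^sub>m n"
  proof (rule eq_matI)
    fix i j assume "i < dim_row (1\<^sub>m n :: complex mat)" "j < dim_col (1\<^sub>m n :: complex mat)"
    hence ij: "i < n" "j < n" by auto
    have "(?M * transpose_mat ?M) $$ (i,j) = complex_of_real (\<Sum>l<n. r i l * r j l)"
      using ij by (simp add: scalar_prod_def lessThan_atLeast0)
    also have "\<dots> = 1\<^sub>m n $$ (i,j)" using assms ij by (simp add: orthonormal_rows_def)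
    finally show "(?M * transpose_mat ?M) $$ (i,j) = 1\<^sub>m n $$ (i,j)" .
  qed auto
  with mat_mult_left_right_inverse[OF M *] show ?thesis by (auto simp: real_orthogonal_mat_def)
qed

lemma real_orthogonal_imp_unitary:
  assumes "real_orthogonal_mat n M"
  shows "unitary_mat n M"
proof -
  have M: "M \<in> carrier_mat n n" using assms by (simp add: real_orthogonal_mat_def)
  have "mat_adjoint M = transpose_mat M"
  proof (rule eq_matI)
    fix i j assume "i < dim_row (transpose_mat M)" "j < dim_col (transpose_mat M)"
    thus "mat_adjoint M $$ (i,j) = transpose_mat M $$ (i,j)"
      using M assms by (auto simp: mat_adjoint_index[OF M] real_orthogonal_mat_def Reals_cnj_iff)
  qed (use M mat_adjoint_carrier[OF M] in auto)
  thus ?thesis using assms by (simp add: real_orthogonal_mat_def unitary_mat_def)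
qed

context onb
begin

lemma ex_unitary_matrix_in_basis:
  assumes "unitary_mat n M"
  obtains R where "unitary_mat n R" "matrix_in_basis n b R = M"
proof
  have M: "M \<in> carrier_mat n n" using assms by (simp add: unitary_mat_def)
  show R: "unitary_mat n (U * M * Us)"
    by (intro unitary_mat_mult unitary_mat_adjoint unitary_basis_mat onb assms)
  show "matrix_in_basis n b (U * M * Us) = M"
    using M U Us by (simp add: matrix_in_basis_eq assoc mult_carrier_mat[of _ n n] unitary unitary_left)
qed

text \<open>Dephasing keeps the populations \<open>q\<close>, and conjugation keeps the entropy.
  \<open>q\<close> is a variable so that \<open>p'\<close> can be substituted for it.\<close>

lemma rel_entropy_coherence_conj_by:
  assumes V: "unitary_mat n V" and q: "\<And>j. j < n \<Longrightarrow> q j = (\<Sum>l<n. (cmod (matrix_in_basis n b V $$ (j,l)))\<^sup>2 * p l)"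
  shows "rel_entropy_coherence n b (conj_by V (diag_op n b (\<lambda>j. complex_of_real (p j)))) =
    - (\<Sum>j<n. q j * log 2 (q j)) - vn_entropy (diag_op n b (\<lambda>j. complex_of_real (p j)))"
proof -
  have "V \<in> carrier_mat n n" using V by (simp add: unitary_mat_def)
  hence "dephase n b (conj_by V (diag_op n b (\<lambda>j. complex_of_real (p j)))) = diag_op n b (\<lambda>j. complex_of_real (q j))"
    unfolding dephase_def by (intro diag_op_cong) (simp add: q matrix_element_conj_by_diag_op)
  thus ?thesis
    by (simp add: rel_entropy_coherence_def vn_entropy_conj_by[OF V] vn_entropy_diag_op)
qed

text \<open>The total is the trace, invariant by cyclicity; the energy trace sees only the
  populations.\<close>

lemma conj_by_diagonal_sums:
  assumes V: "unitary_mat n V" and q: "\<And>j. j < n \<Longrightarrow> q j = (\<Sum>l<n. (cmod (matrix_in_basis n b V $$ (j,l)))\<^sup>2 * p l)"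
  shows "(\<Sum>j<n. q j) = (\<Sum>j<n. p j)"
    and "mat_trace (diag_op n b (\<lambda>j. complex_of_real (E j)) *
        conj_by V (diag_op n b (\<lambda>j. complex_of_real (p j)))) = complex_of_real (\<Sum>j<n. E j * q j)"
proof -
  have Vc: "V \<in> carrier_mat n n" and VV: "mat_adjoint V * V = 1\<^sub>m n"
    using V by (auto simp: unitary_mat_def)
  let ?A = "diag_op n b (\<lambda>j. complex_of_real (p j))"
  note A = diag_op_carrier[of n b "\<lambda>j. complex_of_real (p j)"]
  note c = conj_by_carrier[OF Vc A]
  have "complex_of_real (\<Sum>j<n. q j) = mat_trace (conj_by V ?A)"
    unfolding mat_trace_eq_sum_matrix_element[OF c]
    by (simp add: q matrix_element_conj_by_diag_op[OF Vc])
  also have "\<dots> = mat_trace (mat_adjoint V * (V * ?A))"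
    unfolding conj_by_def
    by (rule mat_trace_comm[of _ n]) (use Vc A mat_adjoint_carrier[OF Vc] in auto)
  also have "mat_adjoint V * (V * ?A) = ?A"
    using Vc A mat_adjoint_carrier[OF Vc] VV by (simp flip: assoc)
  finally show "(\<Sum>j<n. q j) = (\<Sum>j<n. p j)"
    unfolding mat_trace_diag_op by (simp flip: of_real_sum)
  show "mat_trace (diag_op n b (\<lambda>j. complex_of_real (E j)) * conj_by V ?A) = complex_of_real (\<Sum>j<n. E j * q j)"
    unfolding mat_trace_diag_op_mult[OF c]
    by (simp add: q matrix_element_conj_by_diag_op[OF Vc])
qed

end

section \<open>Attaining the thermal populations, and the entropy bound for all unitaries\<close>

theorem theorem1:
  fixes d :: nat and b :: "nat \<Rightarrow> complex vec" and E :: "nat \<Rightarrow> real" and T T' :: real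
    and H \<rho> \<rho>' :: "complex mat" and \<Delta>E :: complex
  assumes "d \<ge> 1"
    and "orthonormal_basis d b"
    and "0 < T" and "T < T'"
    and "H = diag_op d b (\<lambda>j. complex_of_real (E j))"
    and "\<rho> = thermal_state H T"
    and "\<rho>' = thermal_state H T'"
    and "\<Delta>E = mat_trace (H * (\<rho>' - \<rho>))"
  shows "(\<exists>R \<in> carrier_mat d d.
            real_orthogonal_mat d (matrix_in_basis d b R) \<and>
            energy_cost H \<rho> R = \<Delta>E \<and>
            rel_entropy_coherence d b (conj_by R \<rho>) = vn_entropy \<rho>' - vn_entropy \<rho>) \<and>
         (\<forall>V. unitary_mat d V \<and> energy_cost H \<rho> V = \<Delta>E \<longrightarrow>
            rel_entropy_coherence d b (conj_by V \<rho>) \<le> vn_entropy \<rho>' - vn_entropy \<rho>)"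
proof -
  interpret onb d b by unfold_locales (fact assms(2))
  define p p' where "p = gibbs_weight d E T" and "p' = gibbs_weight d E T'"
  have d: "0 < d" using assms(1) by simp
  have H: "H = diag_op d b (\<lambda>j. complex_of_real (E j))" by fact
  have \<rho>: "\<rho> = diag_op d b (\<lambda>j. complex_of_real (p j))"
    and \<rho>': "\<rho>' = diag_op d b (\<lambda>j. complex_of_real (p' j))"
    using assms by (simp_all add: thermal_state_diag_op p_def p'_def)
  have c: "H \<in> carrier_mat d d" "\<rho> \<in> carrier_mat d d" "\<rho>' \<in> carrier_mat d d"
    by (simp_all add: H \<rho> \<rho>' diag_op_carrier)
  have sums: "(\<Sum>j<d. p j) = 1" "(\<Sum>j<d. p' j) = 1"
    using d by (simp_all add: p_def p'_def sum_gibbs_weight)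
  have S': "vn_entropy \<rho>' = - (\<Sum>j<d. p' j * log 2 (p' j))"
    by (simp add: \<rho>' vn_entropy_diag_op)
  have \<rho>'E: "mat_trace (H * \<rho>') = complex_of_real (\<Sum>j<d. E j * p' j)"
    by (simp add: H \<rho>' diag_op_mult mat_trace_diag_op)
  \<comment> \<open>The term \<open>mat_trace (H * \<rho>)\<close> cancels, so the cost condition
    equates mean energies with those of \<open>\<rho>'\<close>.\<close>
  have cost_iff: "energy_cost H \<rho> V = \<Delta>E \<longleftrightarrow> mat_trace (H * conj_by V \<rho>) = mat_trace (H * \<rho>')"
    if "V \<in> carrier_mat d d" for V
    using c conj_by_carrier[OF that c(2)]
    by (simp add: energy_cost_def assms(8) mult_minus_distrib_mat[of _ d d] mat_trace_minus[of _ d])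
  have "(\<Sum>j<d. p j) = (\<Sum>j<d. p' j)" by (simp add: sums)
  \<comment> \<open>Heating supplies the order condition needed to rotate \<open>p\<close> into
    \<open>p'\<close>.\<close>
  moreover have "p' k \<le> p' j" if "p' j < p j" "p k < p' k" for j k
    using gibbs_weight_crossing[OF d assms(3,4)] that by (simp add: p_def p'_def)
  ultimately obtain r where r: "orthonormal_rows d r" and rp: "\<And>i. i < d \<Longrightarrow> weighted_square d p (r i) = p' i"
    using orthogonal_with_diagonal[of p d p'] by blast
  define M where "M = mat d d (\<lambda>(i,j). complex_of_real (r i j))"
  have M: "real_orthogonal_mat d M" unfolding M_def by (rule real_orthogonal_mat_of_rows[OF r])
  then obtain R where R: "unitary_mat d R" "matrix_in_basis d b R = M"
    using ex_unitary_matrix_in_basis[OF real_orthogonal_imp_unitary] by blast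
  \<comment> \<open>The entries of \<open>M\<close> are real, so \<open>cmod\<close> squared is the
    plain square and the sum is the prescribed diagonal.\<close>
  have p'R: "p' j = (\<Sum>l<d. (cmod (matrix_in_basis d b R $$ (j,l)))\<^sup>2 * p l)" if "j < d" for j
    using that rp[of j] by (simp add: R M_def weighted_square_def)
  have Rc: "R \<in> carrier_mat d d" using R by (simp add: unitary_mat_def)
  have "mat_trace (H * conj_by R \<rho>) = complex_of_real (\<Sum>j<d. E j * p' j)"
    unfolding H \<rho> by (rule conj_by_diagonal_sums(2)[OF R(1) p'R])
  hence "energy_cost H \<rho> R = \<Delta>E" by (simp add: cost_iff[OF Rc] \<rho>'E)
  moreover have "rel_entropy_coherence d b (conj_by R \<rho>) = vn_entropy \<rho>' - vn_entropy \<rho>"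
    using rel_entropy_coherence_conj_by[OF R(1) p'R] by (simp add: \<rho> S')
  moreover have "rel_entropy_coherence d b (conj_by V \<rho>) \<le> vn_entropy \<rho>' - vn_entropy \<rho>"
    if V: "unitary_mat d V" and cost: "energy_cost H \<rho> V = \<Delta>E" for V
  proof -
    \<comment> \<open>The populations after \<open>V\<close>: a probability vector with the mean
      energy of \<open>p'\<close>, to which entropy maximality applies.\<close>
    define q where "q = (\<lambda>j. \<Sum>l<d. (cmod (matrix_in_basis d b V $$ (j,l)))\<^sup>2 * p l)"
    have Vc: "V \<in> carrier_mat d d" using V by (simp add: unitary_mat_def)
    have q: "q j = (\<Sum>l<d. (cmod (matrix_in_basis d b V $$ (j,l)))\<^sup>2 * p l)" for j
      by (simp add: q_def)
    have "mat_trace (H * conj_by V \<rho>) = complex_of_real (\<Sum>j<d. E j * q j)"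
      unfolding H \<rho> by (rule conj_by_diagonal_sums(2)[OF V q])
    hence "complex_of_real (\<Sum>j<d. E j * q j) = complex_of_real (\<Sum>j<d. E j * p' j)"
      using cost \<rho>'E by (simp only: cost_iff[OF Vc])
    hence "(\<Sum>j<d. E j * q j) = (\<Sum>j<d. E j * p' j)" by (simp only: of_real_eq_iff)
    moreover have "0 \<le> q j" for j
      unfolding q_def p_def using gibbs_weight_pos[OF d, THEN less_imp_le]
      by (intro sum_nonneg mult_nonneg_nonneg) auto
    moreover have "(\<Sum>j<d. q j) = 1" using conj_by_diagonal_sums(1)[OF V q] sums by simp
    ultimately have "- (\<Sum>j<d. q j * log 2 (q j)) \<le> vn_entropy \<rho>'"
      unfolding S' p'_def by (intro gibbs_weight_max_entropy d) auto
    thus ?thesis using rel_entropy_coherence_conj_by[OF V q] by (simp add: \<rho>)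
  qed
  ultimately show ?thesis using Rc M R by auto
qed

end
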